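(* Let $\Omega\subsetneq\mathbb{R}^n$ be open with $R:=\sup_{x\in\Omega}d(x)<\infty$. For all $u\in C_c^\infty(\Omega)$ and all $s>n$, $$\int_\Omega\frac{|\nabla u|}{d^{s-1}}dx-(s-n)\int_\Omega\frac{|u|}{d^s}dx\ \ge\ \frac{1}{R^{s-n}}\int_\Omega\frac{|\nabla u|}{d^{n-1}}dx.$$
   Context: $d(x):=\operatorname{dist}(x,\mathbb{R}^n\setminus\Omega)$. *)

theory Defs
  imports "HOL-Analysis.Analysis"
begin

definition bdist :: "'a::euclidean_space set \<Rightarrow> 'a \<Rightarrow> real" where
  "bdist \<Omega> x = infdist x (- \<Omega>)"

fun iter_partial :: "'a::euclidean_space list \<Rightarrow> ('a \<Rightarrow> real) \<Rightarrow> 'a \<Rightarrow> real" where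
  "iter_partial [] f = f"
| "iter_partial (b # bs) f = (\<lambda>x. frechet_derivative (iter_partial bs f) (at x) b)"

text \<open>C^infinity on an open set: all iterated partial derivatives exist and are
  (Frechet) differentiable at every point of S (hence all are continuous).\<close>
definition smooth_on :: "'a::euclidean_space set \<Rightarrow> ('a \<Rightarrow> real) \<Rightarrow> bool" where
  "smooth_on S f \<longleftrightarrow>
     (\<forall>bs. set bs \<subseteq> Basis \<longrightarrow> (\<forall>x\<in>S. iter_partial bs f differentiable (at x)))"

definition tsupp :: "('a::euclidean_space \<Rightarrow> real) \<Rightarrow> 'a set" where
  "tsupp f = closure {x. f x \<noteq> 0}"

definition Cc_inf :: "'a::euclidean_space set \<Rightarrow> ('a \<Rightarrow> real) \<Rightarrow> bool" where
  "Cc_inf \<Omega> u \<longleftrightarrow> smooth_on \<Omega> u \<and> compact (tsupp u) \<and> tsupp u \<subseteq> \<Omega>"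

definition grad :: "('a::euclidean_space \<Rightarrow> real) \<Rightarrow> 'a \<Rightarrow> 'a" where
  "grad u x = (\<Sum>b\<in>Basis. frechet_derivative u (at x) b *\<^sub>R b)"

end

theory Submission
  imports Defs "HOL-Real_Asymp.Real_Asymp"
begin

text \<open>
  Formally one tests with the vector field \<open>F = - (d powr (1 - s) - R powr (n - s) * d powr (1 - n)) \<nabla>d\<close>,
  whose divergence is at least \<open>(s - n) * d powr (- s)\<close> because \<open>\<Delta>d \<le> (n - 1) / d\<close>.
  To avoid distributional Laplacians, \<open>d\<close> is replaced by the distance to a finite set of
  points of the complement. Space is then cut into Voronoi cells, each star-shaped about its centre \<open>y\<close>,
  and on a cell the divergence estimate is the derivative at \<open>t = 0\<close> of the change of variables along the contraction
  \<open>x \<mapsto> x + t (y - x)\<close>, which maps the cell into itself. Summing over the cells and letting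
  the finite sets exhaust a dense subset of the complement gives the inequality.
\<close>

section \<open>Integration preliminaries: compact support, affine substitution, bounds for
  powers\<close>

lemma integrable_lborel_bounded_compact_support:
  fixes f :: "'a::euclidean_space \<Rightarrow> real"
  assumes "f \<in> borel_measurable borel" "compact K"
    and "\<And>x. x \<in> K \<Longrightarrow> \<bar>f x\<bar> \<le> B" "\<And>x. x \<notin> K \<Longrightarrow> f x = 0"
  shows "integrable lborel f"
proof (rule Bochner_Integration.integrable_bound)
  show "integrable lborel (\<lambda>x. B * indicator K x)"
    using assms(2) by (intro integrable_mult_right integrable_real_indicator) (use emeasure_compact_finite[OF assms(2)] borel_compact[OF assms(2)] in auto)
  show "AE x in lborel. norm (f x) \<le> norm (B * indicator K x)"
    using assms(3,4) by (auto simp: indicator_def intro: order_trans[OF _ abs_ge_self])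
qed (use assms(1) in simp)

lemma integral_lborel_affine:
  fixes f :: "'a::euclidean_space \<Rightarrow> real" and c :: real
  assumes "f \<in> borel_measurable borel" "0 < c"
  shows "integral\<^sup>L lborel f = c ^ DIM('a) * (\<integral>x. f (a + c *\<^sub>R x) \<partial>lborel)"
proof -
  have "integral\<^sup>L lborel f =
      integral\<^sup>L (density (distr lborel borel (\<lambda>x. a + c *\<^sub>R x)) (\<lambda>_. ennreal (c ^ DIM('a)))) f"
    using lborel_affine[of c a] assms(2) by simp
  also have "\<dots> = c ^ DIM('a) * (\<integral>x. f (a + c *\<^sub>R x) \<partial>lborel)"
    using assms by (simp add: integral_density integral_distr)
  finally show ?thesis .
qed

lemma integrable_lborel_affine:
  fixes f :: "'a::euclidean_space \<Rightarrow> real" and c :: real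
  assumes "integrable lborel f" "0 < c"
  shows "integrable lborel (\<lambda>x. f (a + c *\<^sub>R x))"
proof -
  have [measurable]: "f \<in> borel_measurable borel" using assms(1) by auto
  have "integrable (density (distr lborel borel (\<lambda>x. a + c *\<^sub>R x)) (\<lambda>_. ennreal (c ^ DIM('a)))) f"
    using lborel_affine[of c a] assms by simp
  then show ?thesis
    using assms(2) by (simp add: integrable_density integrable_distr_eq)
qed

text \<open>A power is monotone in one direction or the other, so on an interval away from 0 it is
  bounded by its value at an endpoint. The sum of both values serves every sign of the exponent at
  once.\<close>

lemma powr_le_powr_add_powr:
  fixes r :: real
  assumes "0 < \<delta>" "\<delta> \<le> r" "r \<le> M"
  shows "r powr q \<le> \<delta> powr q + M powr q"
proof (cases "q \<le> 0")
  case True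
  then have "r powr q \<le> \<delta> powr q" using assms by (intro powr_mono2') auto
  then show ?thesis by (simp add: add_increasing2)
next
  case False
  then have "r powr q \<le> M powr q" using assms by (intro powr_mono2) auto
  then show ?thesis by (simp add: add_increasing)
qed

section \<open>Test functions: bounds, integrability and difference quotients\<close>

text \<open>The properties of a test function that the argument works with, on the whole space:
  \<open>u'\<close> represents the derivative as a gradient, and \<open>K\<close> is a compact set
  off which both functions vanish.\<close>

locale C1_compact_support =
  fixes u :: "'a::euclidean_space \<Rightarrow> real" and u' :: "'a \<Rightarrow> 'a" and K :: "'a set"
  assumes deriv: "\<And>x. (u has_derivative (\<lambda>h. u' x \<bullet> h)) (at x)"
    and cont_u': "continuous_on UNIV u'"
    and cpt: "compact K"
    and supp: "\<And>x. x \<notin> K \<Longrightarrow> u x = 0" "\<And>x. x \<notin> K \<Longrightarrow> u' x = 0"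
begin

lemma cont_u: "continuous_on UNIV u"
  using deriv by (intro differentiable_imp_continuous_on) (auto simp: differentiable_on_def differentiable_def)

lemma meas [measurable]: "u \<in> borel_measurable borel" "u' \<in> borel_measurable borel"
  using cont_u cont_u' by (auto intro: borel_measurable_continuous_onI)

lemma bounded_u: obtains B where "0 \<le> B" "\<And>x. \<bar>u x\<bar> \<le> B"
proof -
  have "bounded (u ` K)"
    using cpt cont_u by (meson compact_continuous_image compact_imp_bounded continuous_on_subset subset_UNIV)
  then obtain B where "B > 0" "\<And>x. x \<in> K \<Longrightarrow> \<bar>u x\<bar> \<le> B"
    by (auto simp: bounded_pos)
  then show ?thesis
    using that[of B] supp(1) by (metis abs_zero less_imp_le)
qed

lemma bounded_u': obtains B where "0 \<le> B" "\<And>x. norm (u' x) \<le> B"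
proof -
  have "bounded (u' ` K)"
    using cpt cont_u' by (meson compact_continuous_image compact_imp_bounded continuous_on_subset subset_UNIV)
  then obtain B where "B > 0" "\<And>x. x \<in> K \<Longrightarrow> norm (u' x) \<le> B"
    by (auto simp: bounded_pos)
  then show ?thesis
    using that[of B] supp(2) by (metis norm_zero less_imp_le)
qed

text \<open>Mean value inequality with the bound on the gradient. It later supplies an integrable
  majorant for the difference quotients.\<close>

lemma lipschitz_u: obtains L where "0 \<le> L" "\<And>x z. \<bar>u x - u z\<bar> \<le> L * norm (x - z)"
proof -
  obtain B where B: "0 \<le> B" "\<And>x. norm (u' x) \<le> B" using bounded_u' by blast
  have "onorm (\<lambda>h. u' x \<bullet> h) \<le> B" for x
    by (rule onorm_le) (metis B(2) Cauchy_Schwarz_ineq2 mult_right_mono norm_ge_zero order_trans real_norm_def)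
  then have "norm (u x - u z) \<le> B * norm (x - z)" for x z
    using differentiable_bound[of UNIV u "\<lambda>x h. u' x \<bullet> h" B x z] deriv by (auto intro: has_derivative_at_withinI)
  then show ?thesis using that[of B] B(1) by auto
qed

text \<open>The other factor vanishes off \<open>K\<close>, so the weight has to be bounded only
  there and may be singular elsewhere, as negative powers of a distance are.\<close>

lemma integrable_weighted:
  assumes "f \<in> borel_measurable borel" "\<And>x. x \<in> K \<Longrightarrow> \<bar>f x\<bar> \<le> B"
  shows "integrable lborel (\<lambda>x. \<bar>u x\<bar> * f x)" "integrable lborel (\<lambda>x. norm (u' x) * f x)"
proof -
  note [measurable] = assms(1)
  obtain A where A: "0 \<le> A" "\<And>x. \<bar>u x\<bar> \<le> A" using bounded_u by blast
  obtain A' where A': "0 \<le> A'" "\<And>x. norm (u' x) \<le> A'" using bounded_u' by blast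
  show "integrable lborel (\<lambda>x. \<bar>u x\<bar> * f x)"
    by (rule integrable_lborel_bounded_compact_support[OF _ cpt, where B = "A * B"])
      (use A assms(2) supp in \<open>auto simp: abs_mult intro!: mult_mono\<close>)
  show "integrable lborel (\<lambda>x. norm (u' x) * f x)"
    by (rule integrable_lborel_bounded_compact_support[OF _ cpt, where B = "A' * B"])
      (use A' assms(2) supp in \<open>auto simp: abs_mult intro!: mult_mono\<close>)
qed

lemma integrable_powr_weight:
  assumes [measurable]: "r \<in> borel_measurable borel"
    and "0 < \<delta>" "\<And>x. x \<in> K \<Longrightarrow> \<delta> \<le> r x" "\<And>x. x \<in> K \<Longrightarrow> r x \<le> M"
  shows "integrable lborel (\<lambda>x. \<bar>u x\<bar> * r x powr q)"
    and "integrable lborel (\<lambda>x. norm (u' x) * (r x powr p - c * r x powr q))"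
    and "integrable lborel (\<lambda>x. norm (u' x) * r x powr q)"
proof -
  have *: "r x powr p \<le> \<delta> powr p + M powr p" if "x \<in> K" for x p
    using assms(2-4) that by (intro powr_le_powr_add_powr) auto
  then show "integrable lborel (\<lambda>x. \<bar>u x\<bar> * r x powr q)"
    by (intro integrable_weighted(1)[where B = "\<delta> powr q + M powr q"]) auto
  have i: "integrable lborel (\<lambda>x. norm (u' x) * r x powr q)" for q
    using * by (intro integrable_weighted(2)[where B = "\<delta> powr q + M powr q"]) auto
  then show "integrable lborel (\<lambda>x. norm (u' x) * r x powr q)" .
  show "integrable lborel (\<lambda>x. norm (u' x) * (r x powr p - c * r x powr q))"
    using Bochner_Integration.integrable_diff[OF i[of p] integrable_mult_right[OF i[of q], of c]]
    by (simp add: algebra_simps)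
qed

lemma dist_bounds_on_support:
  assumes "y \<notin> K"
  obtains \<delta> M where "0 < \<delta>" "\<delta> \<le> M" "\<And>x. x \<in> K \<Longrightarrow> \<delta> \<le> dist x y" "\<And>x. x \<in> K \<Longrightarrow> dist x y \<le> M"
proof -
  obtain M where M: "\<And>x. x \<in> K \<Longrightarrow> dist y x \<le> M"
    using compact_imp_bounded[OF cpt] bounded_any_center[of K y] by auto
  obtain \<delta> where \<delta>: "\<delta> > 0" "\<And>x. x \<in> K \<Longrightarrow> \<delta> \<le> dist y x"
    using separate_point_closed[OF compact_imp_closed[OF cpt] assms] by auto
  show ?thesis
    \<comment> \<open>If \<open>K\<close> is empty, \<open>M\<close> is arbitrary; the maximum
      secures \<open>\<delta> \<le> M\<close> in that case too.\<close>
    by (rule that[of \<delta> "max \<delta> M"]) (use M \<delta> in \<open>auto simp: dist_commute le_max_iff_disj\<close>)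
qed

lemma difference_quotient_tendsto:
  assumes "filterlim t (at 0) F"
  shows "((\<lambda>m. \<bar>u x - u (x + t m *\<^sub>R v)\<bar> / \<bar>t m\<bar>) \<longlongrightarrow> \<bar>u' x \<bullet> v\<bar>) F"
proof -
  have "((\<lambda>h. u (x + h *\<^sub>R v)) has_derivative (\<lambda>h. u' x \<bullet> (h *\<^sub>R v))) (at 0)"
    by (rule has_derivative_compose[of "\<lambda>h. x + h *\<^sub>R v" "\<lambda>h. h *\<^sub>R v"])
      (use deriv[of "x + 0 *\<^sub>R v"] in \<open>auto intro!: derivative_eq_intros\<close>)
  then have "((\<lambda>h. u (x + h *\<^sub>R v)) has_real_derivative u' x \<bullet> v) (at 0)"
    by (simp add: has_field_derivative_def mult_commute_abs)
  then have "((\<lambda>h. (u (x + h *\<^sub>R v) - u x) / h) \<longlongrightarrow> u' x \<bullet> v) (at 0)"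
    by (simp add: has_field_derivative_iff)
  then have "((\<lambda>h. \<bar>u x - u (x + h *\<^sub>R v)\<bar> / \<bar>h\<bar>) \<longlongrightarrow> \<bar>u' x \<bullet> v\<bar>) (at 0)"
    by (drule_tac tendsto_rabs) (simp add: abs_divide abs_minus_commute)
  then show ?thesis by (rule filterlim_compose) fact
qed

section \<open>The inequality on one star-shaped cell\<close>

text \<open>Setting of one cell: points of \<open>C\<close> slide towards the centre
  \<open>y\<close> without leaving \<open>C\<close>. Since \<open>y\<close> lies off the compact set
  \<open>K\<close>, powers of the distance to \<open>y\<close> are bounded on the support, and
  \<rho> bounds this distance on the part of the support inside \<open>C\<close>.\<close>

context
  fixes y :: 'a and C :: "'a set" and s \<rho> n :: real
  assumes n: "n = real DIM('a)"
    and y: "y \<notin> K"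
    and C [measurable]: "C \<in> sets borel"
    and star: "\<And>x t. \<lbrakk>x \<in> C; 0 < t; t < 1\<rbrakk> \<Longrightarrow> x + t *\<^sub>R (y - x) \<in> C"
    and \<rho>: "\<And>x. \<lbrakk>x \<in> K; x \<in> C\<rbrakk> \<Longrightarrow> dist x y \<le> \<rho>"
    and s: "n < s"
begin

lemma n_nonneg: "0 \<le> n" by (simp add: n)


text \<open>The weight \<open>r powr (- n) * k r\<close> is chosen so that the factor \<open>(1 - t) powr (- n)\<close> picked up
  by \<open>r powr (- n)\<close> under the contraction \<open>T t\<close> cancels its Jacobian.\<close>

abbreviation (input) k where "k q \<equiv> q powr (n - s) - \<rho> powr (n - s)"
abbreviation (input) T where "T t x \<equiv> x + t *\<^sub>R (y - x)"
abbreviation (input) W where "W x \<equiv> indicat_real C x * (\<bar>u x\<bar> * dist x y powr (- s))"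
abbreviation (input) F where
  "F t x \<equiv> indicat_real C x * (\<bar>u x - u (T t x)\<bar> / t * (dist x y powr (- n) * \<bar>k ((1 - t) * dist x y)\<bar>))"

lemma dist_T: assumes "t < 1" shows "dist (T t x) y = (1 - t) * dist x y"
proof -
  have "T t x - y = (1 - t) *\<^sub>R (x - y)" by (simp add: algebra_simps)
  then show ?thesis using assms by (simp add: dist_norm)
qed

text \<open>The difference \<open>u x - u (T t x)\<close> can be nonzero as soon as one of the two
  points lies in \<open>K\<close>, so both cases have to be covered. For \<open>t \<le> 1/2\<close>
  the contraction at most halves the distance to \<open>y\<close>; hence both distances stay in a
  fixed interval away from 0, and the bounds are uniform in \<open>t\<close>.\<close>

lemma weight_bound:
  obtains M Q where "0 \<le> M" "0 \<le> Q"
    "\<And>x t. \<lbrakk>0 < t; t \<le> 1/2; x \<in> K \<or> T t x \<in> K\<rbrakk> \<Longrightarrow> dist x y \<le> M"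
    "\<And>x t. \<lbrakk>0 < t; t \<le> 1/2; x \<in> K \<or> T t x \<in> K\<rbrakk> \<Longrightarrow> 
        dist x y powr (- n) * \<bar>k ((1 - t) * dist x y)\<bar> \<le> Q"
proof -
  obtain \<delta> M where dM: "0 < \<delta>" "\<delta> \<le> M" "\<And>x. x \<in> K \<Longrightarrow> \<delta> \<le> dist x y" "\<And>x. x \<in> K \<Longrightarrow> dist x y \<le> M"
    using dist_bounds_on_support[OF y] by metis
  have a: "\<delta> \<le> dist x y \<and> \<delta> / 2 \<le> (1 - t) * dist x y \<and> dist x y \<le> 2 * M"
    if t: "0 < t" "t \<le> 1/2" "x \<in> K \<or> T t x \<in> K" for x t
    using t(3)
  proof
    assume "x \<in> K"
    then have "\<delta> \<le> dist x y" "dist x y \<le> M" using dM by auto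
    moreover have "1/2 * dist x y \<le> (1 - t) * dist x y"
      using t by (intro mult_right_mono) auto
    ultimately show ?thesis using dM(1) by auto
  next
    assume "T t x \<in> K"
    then have "\<delta> \<le> (1 - t) * dist x y" "(1 - t) * dist x y \<le> M" 
      using dM(3,4)[OF \<open>T t x \<in> K\<close>] dist_T[of t x] t by auto
    moreover have "1/2 * dist x y \<le> (1 - t) * dist x y"
      using t by (intro mult_right_mono) auto
    moreover have "(1 - t) * dist x y \<le> dist x y"
      using t by (intro mult_left_le_one_le) auto
    ultimately show ?thesis using dM(1) by auto
  qed
  let ?Q = "(\<delta>/2) powr (n - s) + \<rho> powr (n - s)"
  have "dist x y powr (- n) * \<bar>k ((1 - t) * dist x y)\<bar> \<le> \<delta> powr (- n) * ?Q"
    if t: "0 < t" "t \<le> 1/2" "x \<in> K \<or> T t x \<in> K" for x t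
  proof (rule mult_mono)
    show "dist x y powr (- n) \<le> \<delta> powr (- n)"
      using a[OF t] dM(1) n_nonneg by (intro powr_mono2') auto
    have "((1 - t) * dist x y) powr (n - s) \<le> (\<delta>/2) powr (n - s)"
      using a[OF t] dM(1) s by (intro powr_mono2') auto
    moreover have "0 \<le> ((1 - t) * dist x y) powr (n - s)" "0 \<le> \<rho> powr (n - s)" by auto
    ultimately show "\<bar>k ((1 - t) * dist x y)\<bar> \<le> ?Q" by linarith
  qed auto
  then show ?thesis
    using a dM by (intro that[of "2 * M" "\<delta> powr (- n) * ?Q"]) auto
qed

lemma integrable_W: "integrable lborel W"
proof -
  obtain \<delta> M where "0 < \<delta>" "\<And>x. x \<in> K \<Longrightarrow> \<delta> \<le> dist x y" "\<And>x. x \<in> K \<Longrightarrow> dist x y \<le> M"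
    using dist_bounds_on_support[OF y] by metis
  then have "integrable lborel (\<lambda>x. indicator C x *\<^sub>R (\<bar>u x\<bar> * dist x y powr (- s)))"
    by (intro integrable_mult_indicator integrable_powr_weight(1)) auto
  then show ?thesis by simp
qed

text \<open>By the preceding bounds the integrand is bounded and lives in a ball about
  \<open>y\<close>. The factor \<open>f\<close> is kept general because it stands both for the
  shifted function and for the difference quotient.\<close>

lemma integrable_shifted:
  assumes t: "0 < t" "t \<le> 1/2"
    and f: "f \<in> borel_measurable borel" "\<And>x. \<bar>f x\<bar> \<le> B" "\<And>x. \<lbrakk>x \<notin> K; T t x \<notin> K\<rbrakk> \<Longrightarrow> f x = 0"
  shows "integrable lborel (\<lambda>x. indicator C x * (f x * (dist x y powr (- n) * k ((1 - t) * dist x y))))"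
proof -
  obtain M Q where Q: "0 \<le> Q" 
    "\<And>x. x \<in> K \<or> T t x \<in> K \<Longrightarrow> dist x y \<le> M"
    "\<And>x. x \<in> K \<or> T t x \<in> K \<Longrightarrow> dist x y powr (- n) * \<bar>k ((1 - t) * dist x y)\<bar> \<le> Q"
    using weight_bound t by metis
  note [measurable] = f(1)
  have B: "0 \<le> B" using f(2)[of 0] by linarith
  show ?thesis
  proof (rule integrable_lborel_bounded_compact_support[of _ "cball y M" "B * Q"])
    fix x
    show "\<bar>indicator C x * (f x * (dist x y powr (- n) * k ((1 - t) * dist x y)))\<bar> \<le> B * Q"
    proof (cases "x \<in> K \<or> T t x \<in> K")
      case True
      have "\<bar>f x\<bar> * (dist x y powr (- n) * \<bar>k ((1 - t) * dist x y)\<bar>) \<le> B * Q"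
        using Q(3)[OF True] f(2) B by (intro mult_mono) auto
      then show ?thesis using B Q(1) by (auto simp: indicator_def abs_mult)
    next
      case False
      then show ?thesis using f(3)[of x] B Q(1) by auto
    qed
    assume "x \<notin> cball y M"
    then have "f x = 0" using Q(2)[of x] f(3)[of x] by (auto simp: dist_commute)
    then show "indicator C x * (f x * (dist x y powr (- n) * k ((1 - t) * dist x y))) = 0" by simp
  qed auto
qed

text \<open>Substituting \<open>T t x\<close> for \<open>x\<close> turns the right-hand integral
  into the left-hand one, except that the indicator is evaluated at \<open>T t x\<close>. As
  \<open>T t\<close> maps \<open>C\<close> into itself and the integrand is nonnegative, restricting
  to \<open>x\<close> in \<open>C\<close> can only lower the value.\<close>

lemma scaling_inequality:
  assumes t: "0 < t" "t \<le> 1/2"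
  shows "(\<integral>x. indicator C x * (\<bar>u (T t x)\<bar> * (dist x y powr (- n) * k ((1 - t) * dist x y))) \<partial>lborel)
    \<le> (\<integral>x. indicator C x * (\<bar>u x\<bar> * (dist x y powr (- n) * k (dist x y))) \<partial>lborel)" 
    (is "?L \<le> integral\<^sup>L lborel ?g")
    and "integrable lborel (\<lambda>x. indicator C x * (\<bar>u x\<bar> * (dist x y powr (- n) * k (dist x y))))"
proof -
  let ?l = "1 - t"
  obtain \<delta> M where dM: "0 < \<delta>" "\<And>x. x \<in> K \<Longrightarrow> \<delta> \<le> dist x y"
    using dist_bounds_on_support[OF y] by metis
  obtain B where B: "\<And>x. \<bar>u x\<bar> \<le> B" using bounded_u by metis
  have T: "T t x = t *\<^sub>R y + ?l *\<^sub>R x" for x by (simp add: algebra_simps)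
  note [simp] = n_nonneg
  have gT: "?l ^ DIM('a) * ?g (T t x) =
      indicator C (T t x) * (\<bar>u (T t x)\<bar> * (dist x y powr (- n) * k (?l * dist x y)))" for x
  proof -
    have "?l ^ DIM('a) * (?l * dist x y) powr (- n) = dist x y powr (- n)"
      using t by (simp add: n powr_mult powr_minus powr_realpow)
    moreover have "dist (T t x) y = ?l * dist x y" using t by (intro dist_T) auto
    ultimately show ?thesis by (simp only:) (simp add: mult_ac)
  qed
  have g0: "0 \<le> ?g x" for x
  proof (cases "x \<in> K \<and> x \<in> C")
    case True
    then have "\<rho> powr (n - s) \<le> dist x y powr (n - s)"
      using \<rho>[of x] dM(1) dM(2)[of x] s by (intro powr_mono2') auto
    then show ?thesis by auto
  next
    case False
    then show ?thesis using supp(1)[of x] by (auto simp: indicator_def)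
  qed
  have i1: "integrable lborel (\<lambda>x. indicator C x * (\<bar>u (T t x)\<bar> * (dist x y powr (- n) * k (?l * dist x y))))"
    by (rule integrable_shifted[OF t, of _ B]) (use B supp in auto)
  show i2: "integrable lborel ?g"
  proof -
    have "\<bar>indicator C x * (dist x y powr (- n) * k (dist x y))\<bar> 
       \<le> \<delta> powr (- n) * (\<delta> powr (n - s) + \<rho> powr (n - s))" if "x \<in> K" for x
    proof -
      have a: "dist x y powr (- n) \<le> \<delta> powr (- n)" 
        using dM(1) dM(2)[OF that] by (intro powr_mono2') auto
      have "dist x y powr (n - s) \<le> \<delta> powr (n - s)" 
        using dM(1) dM(2)[OF that] s by (intro powr_mono2') auto
      moreover have "0 \<le> dist x y powr (n - s)" "0 \<le> \<rho> powr (n - s)" by auto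
      ultimately have "\<bar>k (dist x y)\<bar> \<le> \<delta> powr (n - s) + \<rho> powr (n - s)" by linarith
      from mult_mono[OF a this] show ?thesis by (auto simp: indicator_def abs_mult)
    qed
    from integrable_weighted(1)[OF _ this] show ?thesis by (simp add: mult_ac)
  qed
  have "integrable lborel (\<lambda>x. ?g (t *\<^sub>R y + ?l *\<^sub>R x))"
    using i2 t by (intro integrable_lborel_affine) auto
  then have "integrable lborel (\<lambda>x. ?l ^ DIM('a) * ?g (T t x))"
    unfolding T by (rule integrable_mult_right)
  moreover have "indicator C x * (\<bar>u (T t x)\<bar> * (dist x y powr (- n) * k (?l * dist x y)))
      \<le> ?l ^ DIM('a) * ?g (T t x)" for x
  proof (cases "x \<in> C")
    case True
    then have "T t x \<in> C" using star[of x t] t by auto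
    then show ?thesis unfolding gT using True by simp
  next
    case False
    then show ?thesis using mult_nonneg_nonneg[OF _ g0[of "T t x"], of "?l ^ DIM('a)"] t
      by (simp del: mult_eq_0_iff zero_le_mult_iff)
  qed
  ultimately have "?L \<le> (\<integral>x. ?l ^ DIM('a) * ?g (T t x) \<partial>lborel)"
    using i1 by (intro integral_mono)
  also have "\<dots> = integral\<^sup>L lborel ?g"
    unfolding T using integral_lborel_affine[of ?g ?l "t *\<^sub>R y"] t by simp
  finally show "?L \<le> integral\<^sup>L lborel ?g" .
qed

text \<open>Replacing \<open>k (dist x y)\<close> by \<open>k ((1 - t) * dist x y)\<close> changes
  the weighted integrand by exactly \<open>(1 - t) powr (n - s) - 1\<close> times \<open>W\<close>.
  The scaling inequality shows that the contracted integral does not exceed the original one, so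
  this surplus is paid for by the variation of \<open>u\<close> along the contraction. Absolute
  values on the weight leave the sign of \<open>k\<close> open until the limit is taken.\<close>

lemma quotient_inequality:
  assumes t: "0 < t" "t \<le> 1/2"
  shows "((1 - t) powr (n - s) - 1) / t * integral\<^sup>L lborel W \<le> integral\<^sup>L lborel (F t)"
proof -
  let ?l = "1 - t"
  let ?w = "\<lambda>x. dist x y powr (- n) * k (?l * dist x y)"
  let ?g = "\<lambda>x. indicator C x * (\<bar>u x\<bar> * (dist x y powr (- n) * k (dist x y)))"
  let ?h = "\<lambda>x. indicator C x * (\<bar>u (T t x)\<bar> * ?w x)"
  obtain B where B: "\<And>x. \<bar>u x\<bar> \<le> B" using bounded_u by metis
  have ih: "integrable lborel ?h"
    by (rule integrable_shifted[OF t, of _ B]) (use B supp in auto)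
  have "integrable lborel (\<lambda>x. indicator C x * (\<bar>u x - u (T t x)\<bar> / t * ?w x))"
  proof (rule integrable_shifted[OF t, of _ "(B + B) / t"])
    fix x show "\<bar>\<bar>u x - u (T t x)\<bar> / t\<bar> \<le> (B + B) / t"
      using B[of x] B[of "T t x"] t by (auto simp: divide_right_mono)
  qed (use supp in auto)
  then have iF: "integrable lborel (F t)"
    by (drule_tac integrable_abs) (use t in \<open>simp add: abs_mult\<close>)
  have le: "?g x + (?l powr (n - s) - 1) * W x - ?h x \<le> t * F t x" for x
  proof -
    have e: "dist x y powr (- n) * k (?l * dist x y) 
      = dist x y powr (- n) * k (dist x y) + (?l powr (n - s) - 1) * dist x y powr (- s)"
    proof -
      have "dist x y powr (- s) = dist x y powr (- n) * dist x y powr (n - s)"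
        by (simp flip: powr_add)
      moreover have "(?l * dist x y) powr (n - s) = ?l powr (n - s) * dist x y powr (n - s)"
        using t by (simp add: powr_mult)
      ultimately show ?thesis by (simp only:) (simp add: algebra_simps)
    qed
    have "?g x + (?l powr (n - s) - 1) * W x - ?h x = indicator C x * ((\<bar>u x\<bar> - \<bar>u (T t x)\<bar>) * ?w x)"
      unfolding e by (simp add: algebra_simps)
    also have "\<dots> \<le> indicator C x * (\<bar>u x - u (T t x)\<bar> * \<bar>?w x\<bar>)"
    proof (intro mult_left_mono)
      have "(\<bar>u x\<bar> - \<bar>u (T t x)\<bar>) * ?w x \<le> \<bar>\<bar>u x\<bar> - \<bar>u (T t x)\<bar>\<bar> * \<bar>?w x\<bar>"
        by (metis abs_ge_self abs_mult)
      also have "\<dots> \<le> \<bar>u x - u (T t x)\<bar> * \<bar>?w x\<bar>"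
        by (intro mult_right_mono abs_triangle_ineq3) auto
      finally show "(\<bar>u x\<bar> - \<bar>u (T t x)\<bar>) * ?w x \<le> \<bar>u x - u (T t x)\<bar> * \<bar>?w x\<bar>" .
    qed auto
    also have "\<dots> = t * F t x" using t by (simp add: abs_mult)
    finally show ?thesis .
  qed
  have ig: "integrable lborel ?g" by (rule scaling_inequality(2)[OF t])
  have "(\<integral>x. ?g x + (?l powr (n - s) - 1) * W x - ?h x \<partial>lborel) \<le> (\<integral>x. t * F t x \<partial>lborel)"
    by (intro integral_mono le Bochner_Integration.integrable_diff Bochner_Integration.integrable_add
        integrable_mult_right ih iF ig integrable_W)
  also have "(\<integral>x. ?g x + (?l powr (n - s) - 1) * W x - ?h x \<partial>lborel)
    = integral\<^sup>L lborel ?g + (?l powr (n - s) - 1) * integral\<^sup>L lborel W - integral\<^sup>L lborel ?h"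
    using ih ig integrable_mult_right[OF integrable_W, of "?l powr (n - s) - 1"]
    by (simp only: Bochner_Integration.integral_diff Bochner_Integration.integral_add
        Bochner_Integration.integrable_add integral_mult_right_zero)
  also have "(\<integral>x. t * F t x \<partial>lborel) = t * integral\<^sup>L lborel (F t)"
    by (rule integral_mult_right_zero)
  finally have "(?l powr (n - s) - 1) * integral\<^sup>L lborel W \<le> t * integral\<^sup>L lborel (F t)"
    using scaling_inequality(1)[OF t] by linarith
  then show ?thesis
    by (simp only: times_divide_eq_left pos_divide_le_eq[OF t(1)] mult.commute[of t])
qed

text \<open>Dominated convergence: the Lipschitz bound controls the quotient by
  \<open>L * dist x y\<close>, the weight is at most \<open>Q\<close>, and everything vanishes
  outside a ball that is the same for all \<open>t\<close>.\<close>

lemma quotient_integral_tendsto: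
  assumes t: "\<And>m. 0 < t m" "\<And>m. t m \<le> 1/2" "t \<longlonglongrightarrow> 0"
  shows "(\<lambda>m. integral\<^sup>L lborel (F (t m))) \<longlonglongrightarrow>
      (\<integral>x. indicator C x * (\<bar>u' x \<bullet> (y - x)\<bar> * (dist x y powr (- n) * \<bar>k (dist x y)\<bar>)) \<partial>lborel)"
proof -
  obtain M Q where Q: "0 \<le> Q" "0 \<le> M"
    "\<And>x t. \<lbrakk>0 < t; t \<le> 1/2; x \<in> K \<or> T t x \<in> K\<rbrakk> \<Longrightarrow> dist x y \<le> M"
    "\<And>x t. \<lbrakk>0 < t; t \<le> 1/2; x \<in> K \<or> T t x \<in> K\<rbrakk> \<Longrightarrow> 
        dist x y powr (- n) * \<bar>k ((1 - t) * dist x y)\<bar> \<le> Q"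
    using weight_bound by metis
  obtain L where L: "0 \<le> L" "\<And>x z. \<bar>u x - u z\<bar> \<le> L * norm (x - z)"
    using lipschitz_u by metis
  have t0: "filterlim t (at 0) sequentially"
    using t by (auto simp: filterlim_at less_imp_neq[THEN not_sym])
  show ?thesis
  proof (rule integral_dominated_convergence[where w = "\<lambda>x. L * M * Q * indicator (cball y M) x"])
    show "integrable lborel (\<lambda>x. L * M * Q * indicat_real (cball y M) x)"
      using emeasure_compact_finite[of "cball y M"]
      by (intro integrable_mult_right integrable_real_indicator) auto
    show "AE x in lborel. (\<lambda>m. F (t m) x) \<longlonglongrightarrow>
      indicator C x * (\<bar>u' x \<bullet> (y - x)\<bar> * (dist x y powr (- n) * \<bar>k (dist x y)\<bar>))"
    proof (rule AE_I2)
      fix x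
      have q: "(\<lambda>m. \<bar>u x - u (T (t m) x)\<bar> / t m) \<longlonglongrightarrow> \<bar>u' x \<bullet> (y - x)\<bar>"
        using difference_quotient_tendsto[OF t0, of x "y - x"] t(1) by (simp add: less_imp_le)
      show "(\<lambda>m. F (t m) x) \<longlonglongrightarrow>
        indicator C x * (\<bar>u' x \<bullet> (y - x)\<bar> * (dist x y powr (- n) * \<bar>k (dist x y)\<bar>))"
      \<comment> \<open>At the centre every term is 0; elsewhere the base of the power has a
        positive limit, where \<open>powr\<close> is continuous.\<close>
      proof (cases "dist x y = 0")
        case False
        have "(\<lambda>m. (1 - t m) * dist x y) \<longlonglongrightarrow> (1 - 0) * dist x y"
          using t(3) by (intro tendsto_intros)
        then have "(\<lambda>m. ((1 - t m) * dist x y) powr (n - s)) \<longlonglongrightarrow> dist x y powr (n - s)"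
          using False by (intro tendsto_powr) auto
        then show ?thesis
          by (intro tendsto_mult tendsto_const tendsto_rabs tendsto_diff q)
      qed auto
    qed
    fix m
    show "AE x in lborel. norm (F (t m) x) \<le> L * M * Q * indicator (cball y M) x"
    proof (rule AE_I2)
      fix x
      show "norm (F (t m) x) \<le> L * M * Q * indicator (cball y M) x"
      proof (cases "x \<in> K \<or> T (t m) x \<in> K")
        case True
        note b = Q(3,4)[OF t(1,2) True]
        have "\<bar>u x - u (T (t m) x)\<bar> \<le> t m * (L * dist x y)"
          using L(2)[of x "T (t m) x"] t(1)[of m] by (simp add: dist_norm norm_minus_commute mult_ac)
        then have "\<bar>u x - u (T (t m) x)\<bar> / t m \<le> L * dist x y"
          using t(1)[of m] by (simp add: field_simps)
        also have "\<dots> \<le> L * M" using b L by (intro mult_left_mono)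
        finally have "\<bar>u x - u (T (t m) x)\<bar> / t m * (dist x y powr (- n) * \<bar>k ((1 - t m) * dist x y)\<bar>) 
            \<le> (L * M) * Q"
          using b L Q by (intro mult_mono) auto
        moreover have "x \<in> cball y M" using b by (simp add: dist_commute)
        ultimately show ?thesis using L Q t(1)[of m] by (auto simp: indicator_def abs_mult)
      qed (use L Q supp in auto)
    qed
  qed auto
qed

text \<open>The quotient inequality is differentiated at \<open>t = 0\<close>. The factor in front
  of \<open>W\<close> tends to the derivative of \<open>(1 - h) powr (n - s)\<close> at 0, which is
  \<open>s - n\<close>; on the other side Cauchy-Schwarz bounds the radial derivative by the
  gradient, and the extra factor \<open>dist x y\<close> raises each exponent by 1.\<close>

lemma star_cell_inequality:
  "(s - n) * integral\<^sup>L lborel W \<le> (\<integral>x. indicator C x *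
      (norm (u' x) * (dist x y powr (1 - s) - \<rho> powr (n - s) * dist x y powr (1 - n))) \<partial>lborel)"
proof -
  obtain \<delta> M where dM: "0 < \<delta>" "\<And>x. x \<in> K \<Longrightarrow> \<delta> \<le> dist x y" "\<And>x. x \<in> K \<Longrightarrow> dist x y \<le> M"
    using dist_bounds_on_support[OF y] by metis
  let ?D = "\<lambda>x. indicator C x * (\<bar>u' x \<bullet> (y - x)\<bar> * (dist x y powr (- n) * \<bar>k (dist x y)\<bar>))"
  let ?E = "\<lambda>x. indicator C x *
      (norm (u' x) * (dist x y powr (1 - s) - \<rho> powr (n - s) * dist x y powr (1 - n)))"
  \<comment> \<open>The shift by 2 keeps \<open>t m\<close> at most 1/2 from \<open>m = 0\<close>
    on.\<close>
  define t where "t m = inverse (real m + 2)" for m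
  have t: "0 < t m" "t m \<le> 1/2" for m by (auto simp: t_def field_simps)
  have t0: "t \<longlonglongrightarrow> 0" unfolding t_def by real_asymp
  have "((\<lambda>h. (1 - h) powr (n - s)) has_real_derivative (s - n)) (at 0)"
    by (auto intro!: derivative_eq_intros)
  then have "((\<lambda>h. ((1 - h) powr (n - s) - 1) / h) \<longlongrightarrow> s - n) (at 0)"
    by (simp add: has_field_derivative_iff)
  moreover have "filterlim t (at 0) sequentially"
    using t t0 by (auto simp: filterlim_at less_imp_neq[THEN not_sym])
  ultimately have "(\<lambda>m. ((1 - t m) powr (n - s) - 1) / t m) \<longlonglongrightarrow> s - n"
    by (rule filterlim_compose)
  then have "(\<lambda>m. ((1 - t m) powr (n - s) - 1) / t m * integral\<^sup>L lborel W) \<longlonglongrightarrow> (s - n) * integral\<^sup>L lborel W"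
    by (rule tendsto_mult_right)
  then have "(s - n) * integral\<^sup>L lborel W \<le> integral\<^sup>L lborel ?D"
    using LIMSEQ_le[OF _ quotient_integral_tendsto[OF t t0]] quotient_inequality[OF t] by blast
  also have "\<dots> \<le> integral\<^sup>L lborel ?E"
  proof -
    have le: "?D x \<le> ?E x" for x
    proof (cases "x \<in> K \<and> x \<in> C")
      case True
      then have r: "0 < dist x y" "dist x y \<le> \<rho>" using \<rho>[of x] dM(1) dM(2)[of x] by auto
      \<comment> \<open>On the support inside the cell the absolute value around \<open>k\<close>
        can now be dropped.\<close>
      then have k: "0 \<le> k (dist x y)" using powr_mono2'[of "n - s" "dist x y" \<rho>] s by simp
      have "\<bar>u' x \<bullet> (y - x)\<bar> * (dist x y powr (- n) * k (dist x y))
          \<le> (norm (u' x) * dist x y) * (dist x y powr (- n) * k (dist x y))"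
        using k Cauchy_Schwarz_ineq2[of "u' x" "y - x"]
        by (intro mult_right_mono) (auto simp: dist_norm norm_minus_commute)
      also have "\<dots> = norm (u' x) * (dist x y powr 1 * dist x y powr (- n) * dist x y powr (n - s) 
         - \<rho> powr (n - s) * (dist x y powr 1 * dist x y powr (- n)))"
        using r by (simp add: algebra_simps)
      also have "\<dots> = norm (u' x) * (dist x y powr (1 - s) - \<rho> powr (n - s) * dist x y powr (1 - n))"
      proof -
        have "dist x y powr 1 * dist x y powr (- n) * dist x y powr (n - s) = dist x y powr (1 - s)"
          "dist x y powr 1 * dist x y powr (- n) = dist x y powr (1 - n)"
          unfolding powr_add[symmetric] by (auto intro!: arg_cong[where f = "\<lambda>e. dist x y powr e"])
        then show ?thesis by (simp only:)
      qed
      finally show ?thesis using True k by simp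
    qed (use supp in \<open>auto simp: indicator_def\<close>)
    have "integrable lborel (\<lambda>x. indicator C x *\<^sub>R
        (norm (u' x) * (dist x y powr (1 - s) - \<rho> powr (n - s) * dist x y powr (1 - n))))"
      using dM by (intro integrable_mult_indicator integrable_powr_weight(2)) auto
    then have iE: "integrable lborel ?E" by simp
    show ?thesis
    \<comment> \<open>This form of monotonicity asks for integrability and nonnegativity of the
      larger side \<open>?E\<close>.\<close>
    proof (rule integral_mono_AE')
      show "integrable lborel ?E" by (rule iE)
      show "AE x in lborel. ?D x \<le> ?E x" using le by auto
      show "AE x in lborel. 0 \<le> ?E x" using le by (intro AE_I2 order_trans[OF _ le]) auto
    qed
  qed
  finally show ?thesis .
qed

end

section \<open>Finite point sets: summation over Voronoi cells\<close>

text \<open>On the cell of \<open>y i\<close> the distance to the finite set is the distance to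
  \<open>y i\<close>, so the cell inequality applies with that centre. The cells partition the
  space, and the common bound \<rho> lets the estimates be added.\<close>

lemma voronoi_inequality:
  fixes y :: "nat \<Rightarrow> 'a" and m :: nat
  defines "d \<equiv> \<lambda>x. infdist x (y ` {..m})"
  assumes y: "\<And>i. y i \<notin> K"
    and \<rho>: "\<And>x. x \<in> K \<Longrightarrow> d x \<le> \<rho>"
    and s: "real DIM('a) < s"
    and \<delta>: "0 < \<delta>" "\<And>x. x \<in> K \<Longrightarrow> \<delta> \<le> d x"
  shows "(s - real DIM('a)) * (\<integral>x. \<bar>u x\<bar> * d x powr (- s) \<partial>lborel) \<le>
    (\<integral>x. norm (u' x) * (d x powr (1 - s) - \<rho> powr (real DIM('a) - s) * d x powr (1 - real DIM('a))) \<partial>lborel)"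
    (is "_ * integral\<^sup>L lborel ?W \<le> integral\<^sup>L lborel ?E")
proof -
  define cell where "cell i = {x. dist x (y i) = d x \<and> (\<forall>j<i. d x < dist x (y j))}" for i
  have [measurable]: "d \<in> borel_measurable borel"
    unfolding d_def by (intro borel_measurable_continuous_onI continuous_intros)
  have cell_sets [measurable]: "cell i \<in> sets borel" for i
  proof -
    have "Measurable.pred borel (\<lambda>x. dist x (y i) = d x \<and> (\<forall>j<i. d x < dist x (y j)))"
      by measurable
    then show ?thesis by (simp add: cell_def pred_def)
  qed
  have d_le: "d x \<le> dist x (y j)" if "j \<le> m" for x j
    unfolding d_def using that by (intro infdist_le) auto
  have d_attained: "\<exists>j\<le>m. d x = dist x (y j)" for x
  proof -
    have "closed (y ` {..m})" "y ` {..m} \<noteq> {}" by (auto intro: finite_imp_closed)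
    from infdist_attains_inf[OF this, of x] show ?thesis by (auto simp: d_def)
  qed
  \<comment> \<open>The move towards \<open>y i\<close> shortens the distance to \<open>y i\<close>
    by exactly \<open>t * d x\<close> and the distance to any other point by at most that much. So
    \<open>y i\<close> stays nearest, and strict inequalities stay strict.\<close>
  have star: "x + t *\<^sub>R (y i - x) \<in> cell i" if "i \<le> m" "x \<in> cell i" "0 < t" "t < 1" for i x t
  proof -
    let ?x = "x + t *\<^sub>R (y i - x)"
    have x: "dist x (y i) = d x" "\<And>j. j < i \<Longrightarrow> d x < dist x (y j)"
      using that by (auto simp: cell_def)
    have "?x - y i = (1 - t) *\<^sub>R (x - y i)" by (simp add: algebra_simps)
    then have 1: "dist ?x (y i) = (1 - t) * d x" using that x(1) by (simp add: dist_norm)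
    have "dist x ?x = t * d x" using that x(1) by (simp add: dist_norm norm_minus_commute)
    then have 2: "dist x (y j) - t * d x \<le> dist ?x (y j)" for j
      using dist_triangle[of x "y j" ?x] by linarith
    obtain j where j: "j \<le> m" "d ?x = dist ?x (y j)" using d_attained by blast
    have "(1 - t) * d x \<le> d ?x" using j 2[of j] d_le[of j x] by (simp add: algebra_simps)
    then have 3: "d ?x = (1 - t) * d x" using d_le[OF \<open>i \<le> m\<close>, of ?x] 1 by linarith
    have "d ?x < dist ?x (y j)" if "j < i" for j
      using 2[of j] x(2)[OF that] unfolding 3 by (simp add: algebra_simps)
    then show ?thesis using 1 3 by (simp add: cell_def)
  qed
  \<comment> \<open>the strict inequalities for smaller indices break ties, so the cells are disjoint\<close>
  have partition: "(\<Sum>i\<le>m. indicat_real (cell i) x) = 1" for x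
  proof -
    \<comment> \<open>The least index is sought among all naturals, but some index up to
      \<open>m\<close> attains the distance, so the least one is also at most
      \<open>m\<close>.\<close>
    define i where "i = (LEAST i. dist x (y i) = d x)"
    obtain j where j: "j \<le> m" "dist x (y j) = d x" using d_attained[of x] by auto
    have i: "dist x (y i) = d x" "i \<le> m"
      using LeastI[of "\<lambda>i. dist x (y i) = d x" j] Least_le[of "\<lambda>i. dist x (y i) = d x" j] j
      by (auto simp: i_def)
    have "d x < dist x (y j)" if "j < i" for j
      using not_less_Least[of j "\<lambda>i. dist x (y i) = d x"] d_le[of j x] that i(2) by (fastforce simp: i_def)
    then have "x \<in> cell i" using i by (simp add: cell_def)
    moreover have "x \<notin> cell j" if "j \<noteq> i" for j
      using that i Least_le[of "\<lambda>i. dist x (y i) = d x" j]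
      by (fastforce simp: cell_def i_def[symmetric] dest: le_neq_implies_less)
    ultimately have "indicat_real (cell j) x = (if j = i then 1 else 0)" for j by auto
    then show ?thesis using i by simp
  qed
  have split: "integral\<^sup>L lborel f = (\<Sum>i\<le>m. \<integral>x. indicator (cell i) x * f x \<partial>lborel)"
    if f: "integrable lborel f" for f :: "'a \<Rightarrow> real"
  proof -
    have "integral\<^sup>L lborel f = (\<integral>x. (\<Sum>i\<le>m. indicator (cell i) x * f x) \<partial>lborel)"
      by (simp add: partition flip: sum_distrib_right)
    also have "\<dots> = (\<Sum>i\<le>m. \<integral>x. indicator (cell i) x * f x \<partial>lborel)"
      using integrable_mult_indicator[OF _ f] by (intro Bochner_Integration.integral_sum) auto
    finally show ?thesis .
  qed
  have "(s - real DIM('a)) * integral\<^sup>L lborel ?W =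
      (\<Sum>i\<le>m. (s - real DIM('a)) * (\<integral>x. indicator (cell i) x * ?W x \<partial>lborel))"
    using \<delta> \<rho> by (subst split) (auto simp: sum_distrib_left intro!: integrable_powr_weight[where \<delta> = \<delta> and M = \<rho>])
  also have "\<dots> \<le> (\<Sum>i\<le>m. \<integral>x. indicator (cell i) x * ?E x \<partial>lborel)"
  proof (rule sum_mono)
    fix i assume i: "i \<in> {..m}"
    have eq: "indicator (cell i) x * g (d x) = indicator (cell i) x * g (dist x (y i))"
      for x and g :: "real \<Rightarrow> real" by (auto simp: cell_def indicator_def)
    have "(s - real DIM('a)) * (\<integral>x. indicator (cell i) x * (\<bar>u x\<bar> * dist x (y i) powr (- s)) \<partial>lborel)
       \<le> (\<integral>x. indicator (cell i) x * (norm (u' x) * (dist x (y i) powr (1 - s)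
            - \<rho> powr (real DIM('a) - s) * dist x (y i) powr (1 - real DIM('a)))) \<partial>lborel)"
      by (rule star_cell_inequality[OF refl]) (use i star y s \<rho> in \<open>auto simp: cell_def\<close>)
    then show "(s - real DIM('a)) * (\<integral>x. indicator (cell i) x * ?W x \<partial>lborel)
        \<le> (\<integral>x. indicator (cell i) x * ?E x \<partial>lborel)"
      by (subst (1 2) eq)
  qed
  also have "\<dots> = integral\<^sup>L lborel ?E"
    using \<delta> \<rho> by (subst split) (auto intro!: integrable_powr_weight[where \<delta> = \<delta> and M = \<rho>])
  finally show ?thesis .
qed

section \<open>General closed sets: approximation by finite subsets\<close>

text \<open>The distances to the first points of a dense sequence in \<open>S\<close> converge to
  the distance to \<open>S\<close>. They approach it from above and may exceed \<open>R\<close>, so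
  the inequality is first obtained with any \<rho> larger than \<open>R\<close>, and then \<rho>
  decreases to \<open>R\<close>.\<close>

lemma hardy_inequality_infdist:
  assumes S: "closed S" "S \<noteq> {}" "S \<inter> K = {}"
    and R: "0 < R" "\<And>x. x \<in> K \<Longrightarrow> infdist x S \<le> R"
    and s: "real DIM('a) < s"
  shows "(s - real DIM('a)) * (\<integral>x. \<bar>u x\<bar> * infdist x S powr (- s) \<partial>lborel) \<le>
    (\<integral>x. norm (u' x) * infdist x S powr (1 - s) \<partial>lborel)
      - R powr (real DIM('a) - s) * (\<integral>x. norm (u' x) * infdist x S powr (1 - real DIM('a)) \<partial>lborel)"
proof -
  let ?n = "real DIM('a)"
  obtain Y where Y: "countable Y" "Y \<subseteq> S" "S \<subseteq> closure Y" using separable by blast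
  then have "Y \<noteq> {}" using S(2) by auto
  define y where "y = from_nat_into Y"
  have y: "range y = Y" using Y(1) \<open>Y \<noteq> {}\<close> by (simp add: y_def range_from_nat_into)
  define d where "d m x = infdist x (y ` {..m})" for m x
  have yS: "y i \<in> S" for i using y Y(2) by auto
  have yK: "y i \<notin> K" for i using yS S(3) by auto
  have d_le: "d m x \<le> dist x (y i)" if "i \<le> m" for i m x
    unfolding d_def using that by (intro infdist_le) auto
  have le_d: "infdist x S \<le> d m x" for m x
    unfolding d_def using yS by (intro infdist_mono) auto
  have near: "\<exists>i. dist x (y i) < infdist x S + e" if e: "0 < e" for x e
  proof -
    obtain p where p: "p \<in> S" "infdist x S = dist x p" using infdist_attains_inf[OF S(1,2)] by blast
    then have "p \<in> closure Y" using Y(3) by auto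
    then obtain q where "q \<in> Y" "dist q p < e" using e unfolding closure_approachable by blast
    moreover from this obtain i where "q = y i" using y by auto
    ultimately show ?thesis
      using p(2) dist_triangle[of x q p] by (intro exI[of _ i]) (auto simp: dist_commute)
  qed
  have lim: "(\<lambda>m. d m x) \<longlonglongrightarrow> infdist x S" for x
  proof (rule LIMSEQ_I)
    fix e :: real assume "0 < e"
    then obtain i where "dist x (y i) < infdist x S + e" using near by blast
    then have "norm (d m x - infdist x S) < e" if "i \<le> m" for m
      using d_le[OF that, of x] le_d[of x m] by auto
    then show "\<exists>i. \<forall>m\<ge>i. norm (d m x - infdist x S) < e" by blast
  qed
  \<comment> \<open>The point \<open>y 0\<close> belongs to all the finite sets, so its distance
    bounds every \<open>d m\<close> on \<open>K\<close>. Together with the positive lower bound this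
    makes the majorants independent of \<open>m\<close>.\<close>
  obtain M where M: "\<And>x. x \<in> K \<Longrightarrow> dist x (y 0) \<le> M"
    using dist_bounds_on_support[OF yK[of 0]] by metis
  obtain \<delta> where \<delta>: "0 < \<delta>" "\<And>x. x \<in> K \<Longrightarrow> \<delta> \<le> infdist x S"
  proof -
    obtain e where e: "e > 0" "\<And>x z. \<lbrakk>x \<in> K; z \<in> S\<rbrakk> \<Longrightarrow> e \<le> dist x z"
      using separate_compact_closed[OF cpt S(1)] S(3) by (auto simp: Int_commute)
    then show thesis
      using infdist_attains_inf[OF S(1,2)] by (intro that[of e]) metis+
  qed
  have \<delta>d: "\<delta> \<le> d m x" "d m x \<le> M" if "x \<in> K" for m x
    using \<delta>(2)[OF that] le_d[of x m] d_le[of 0 m x] M[OF that] by auto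
  have [measurable]: "d m \<in> borel_measurable borel" "(\<lambda>x. infdist x S) \<in> borel_measurable borel" for m
    unfolding d_def by (auto intro!: borel_measurable_continuous_onI continuous_intros)
  have lim_powr: "(\<lambda>m. d m x powr q) \<longlonglongrightarrow> infdist x S powr q" if "x \<in> K" for x q
    using lim[of x] \<delta>(1) \<delta>(2)[OF that] by (intro tendsto_powr) auto
  have bound: "d m x powr q \<le> \<delta> powr q + M powr q" if "x \<in> K" for x m q
    using \<delta>(1) \<delta>d[OF that] by (intro powr_le_powr_add_powr) auto
  let ?A = "\<integral>x. \<bar>u x\<bar> * infdist x S powr (- s) \<partial>lborel"
  let ?G = "\<lambda>q. \<integral>x. norm (u' x) * infdist x S powr q \<partial>lborel"
  have lim_A: "(\<lambda>m. \<integral>x. \<bar>u x\<bar> * d m x powr (- s) \<partial>lborel) \<longlonglongrightarrow> ?A"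
  proof (rule integral_dominated_convergence[where w = "\<lambda>x. \<bar>u x\<bar> * (\<delta> powr (- s) + M powr (- s))"])
    show "integrable lborel (\<lambda>x. \<bar>u x\<bar> * (\<delta> powr (- s) + M powr (- s)))"
      by (intro integrable_weighted[where B = "\<bar>\<delta> powr (- s) + M powr (- s)\<bar>"]) auto
    show "AE x in lborel. (\<lambda>m. \<bar>u x\<bar> * d m x powr (- s)) \<longlonglongrightarrow> \<bar>u x\<bar> * infdist x S powr (- s)"
    proof (rule AE_I2)
      fix x show "(\<lambda>m. \<bar>u x\<bar> * d m x powr (- s)) \<longlonglongrightarrow> \<bar>u x\<bar> * infdist x S powr (- s)"
        using lim_powr[of x] supp by (cases "x \<in> K") (auto intro!: tendsto_mult)
    qed
    show "AE x in lborel. norm (\<bar>u x\<bar> * d m x powr (- s)) \<le> \<bar>u x\<bar> * (\<delta> powr (- s) + M powr (- s))" for m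
    proof (rule AE_I2)
      fix x show "norm (\<bar>u x\<bar> * d m x powr (- s)) \<le> \<bar>u x\<bar> * (\<delta> powr (- s) + M powr (- s))"
        using bound[of x m] supp by (cases "x \<in> K") (auto simp: abs_mult intro!: mult_left_mono)
    qed
  qed auto
  have lim_G: "(\<lambda>m. \<integral>x. norm (u' x) * d m x powr q \<partial>lborel) \<longlonglongrightarrow> ?G q" for q
  proof (rule integral_dominated_convergence[where w = "\<lambda>x. norm (u' x) * (\<delta> powr q + M powr q)"])
    show "integrable lborel (\<lambda>x. norm (u' x) * (\<delta> powr q + M powr q))"
      by (intro integrable_weighted[where B = "\<bar>\<delta> powr q + M powr q\<bar>"]) auto
    show "AE x in lborel. (\<lambda>m. norm (u' x) * d m x powr q) \<longlonglongrightarrow> norm (u' x) * infdist x S powr q"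
    proof (rule AE_I2)
      fix x show "(\<lambda>m. norm (u' x) * d m x powr q) \<longlonglongrightarrow> norm (u' x) * infdist x S powr q"
        using lim_powr[of x] supp by (cases "x \<in> K") (auto intro!: tendsto_mult)
    qed
    show "AE x in lborel. norm (norm (u' x) * d m x powr q) \<le> norm (u' x) * (\<delta> powr q + M powr q)" for m
    proof (rule AE_I2)
      fix x show "norm (norm (u' x) * d m x powr q) \<le> norm (u' x) * (\<delta> powr q + M powr q)"
        using bound[of x m] supp by (cases "x \<in> K") (auto simp: abs_mult intro!: mult_left_mono)
    qed
  qed auto
  \<comment> \<open>Each point of \<open>K\<close> is within \<open>R\<close> of \<open>S\<close>,
    hence within \<rho> of some \<open>y i\<close>. By compactness finitely many indices suffice, so
    \<open>d m\<close> is at most \<rho> on all of \<open>K\<close> once \<open>m\<close> passes the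
    largest of them.\<close>
  have ineq: "(s - ?n) * ?A \<le> ?G (1 - s) - \<rho> powr (?n - s) * ?G (1 - ?n)" if \<rho>: "R < \<rho>" for \<rho>
  proof -
    have "K \<subseteq> (\<Union>i\<in>UNIV. ball (y i) \<rho>)"
    proof
      fix x assume "x \<in> K"
      then obtain i where "dist x (y i) < infdist x S + (\<rho> - R)" using near[of "\<rho> - R" x] \<rho> by auto
      then show "x \<in> (\<Union>i\<in>UNIV. ball (y i) \<rho>)" using R(2)[OF \<open>x \<in> K\<close>]
        by (auto simp: dist_commute intro!: exI[of _ i])
    qed
    then obtain I where I: "finite I" "K \<subseteq> (\<Union>i\<in>I. ball (y i) \<rho>)"
      using compactE_image[OF cpt, of UNIV "\<lambda>i. ball (y i) \<rho>"] by auto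
    obtain N where N: "\<And>i. i \<in> I \<Longrightarrow> i \<le> N" using I(1) finite_nat_set_iff_bounded_le by auto
    have "(s - ?n) * (\<integral>x. \<bar>u x\<bar> * d m x powr (- s) \<partial>lborel) \<le>
        (\<integral>x. norm (u' x) * d m x powr (1 - s) \<partial>lborel)
          - \<rho> powr (?n - s) * (\<integral>x. norm (u' x) * d m x powr (1 - ?n) \<partial>lborel)" if "N \<le> m" for m
    proof -
      have "d m x \<le> \<rho>" if x: "x \<in> K" for x
      proof -
        obtain i where "i \<in> I" "dist x (y i) < \<rho>" using I(2) x by (auto simp: dist_commute)
        then show ?thesis using d_le[of i m x] N[of i] \<open>N \<le> m\<close> by auto
      qed
      then have "(s - ?n) * (\<integral>x. \<bar>u x\<bar> * d m x powr (- s) \<partial>lborel) \<le>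
        (\<integral>x. norm (u' x) * (d m x powr (1 - s) - \<rho> powr (?n - s) * d m x powr (1 - ?n)) \<partial>lborel)"
        using voronoi_inequality[of y m \<rho> s \<delta>] yK s \<delta>(1) \<delta>d(1) unfolding d_def by blast
      also have "\<dots> = (\<integral>x. norm (u' x) * d m x powr (1 - s)
          - \<rho> powr (?n - s) * (norm (u' x) * d m x powr (1 - ?n)) \<partial>lborel)"
        by (simp add: algebra_simps)
      also have "\<dots> = (\<integral>x. norm (u' x) * d m x powr (1 - s) \<partial>lborel)
          - \<rho> powr (?n - s) * (\<integral>x. norm (u' x) * d m x powr (1 - ?n) \<partial>lborel)"
        using \<delta>(1) \<delta>d[of _ m]
        by (subst Bochner_Integration.integral_diff) (auto intro!: integrable_powr_weight(3))
      finally show ?thesis .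
    qed
    then show ?thesis
      by (intro LIMSEQ_le[OF tendsto_mult_left[OF lim_A]
            tendsto_diff[OF lim_G tendsto_mult_left[OF lim_G]]]) blast
  qed
  \<comment> \<open>Only \<rho> in the coefficient varies, and the power is continuous at
    \<open>R\<close> because \<open>R\<close> is positive.\<close>
  have "((\<lambda>\<rho>. ?G (1 - s) - \<rho> powr (?n - s) * ?G (1 - ?n)) \<longlongrightarrow>
      ?G (1 - s) - R powr (?n - s) * ?G (1 - ?n)) (at_right R)"
    using R(1) by (intro tendsto_intros) auto
  then show ?thesis
    by (rule tendsto_lowerbound) (auto simp: eventually_at_right_less intro: eventually_mono[OF eventually_at_right_less] ineq)
qed

end

section \<open>Transfer to smooth functions and Lebesgue integrals over the domain\<close>

text \<open>\<open>smooth_on\<close> speaks only about points of \<Omega>. Every other point lies in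
  the open complement of the support, where \<open>u\<close> is locally 0; the two cases together
  give a continuous gradient on the whole space.\<close>

lemma Cc_inf_C1_compact_support:
  fixes u :: "'a::euclidean_space \<Rightarrow> real"
  assumes "open \<Omega>" "Cc_inf \<Omega> u"
  shows "C1_compact_support u (grad u) (tsupp u)"
proof
  have u: "smooth_on \<Omega> u" "compact (tsupp u)" "tsupp u \<subseteq> \<Omega>"
    using assms(2) by (auto simp: Cc_inf_def)
  have op: "open (- tsupp u)" by (simp add: tsupp_def open_closed)
  show u0: "u x = 0" if "x \<notin> tsupp u" for x
    using that closure_subset[of "{x. u x \<noteq> 0}"] by (auto simp: tsupp_def)
  have off: "(u has_derivative (\<lambda>_. 0)) (at x)" if "x \<notin> tsupp u" for x
    by (rule has_derivative_transform_within_open[OF has_derivative_const op]) (use that u0 in auto)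
  have D0: "frechet_derivative u (at x) = (\<lambda>_. 0)" if "x \<notin> tsupp u" for x
    using frechet_derivative_at[OF off[OF that]] by simp
  then show "grad u x = 0" if "x \<notin> tsupp u" for x
    using that by (simp add: grad_def)
  have "u differentiable (at x)" for x
  proof (cases "x \<in> tsupp u")
    case True
    then have "iter_partial [] u differentiable (at x)" 
      using u unfolding smooth_on_def by (metis empty_subsetI list.set(1) subsetD)
    then show ?thesis by simp
  qed (use off in \<open>auto simp: differentiable_def\<close>)
  then have D: "(u has_derivative frechet_derivative u (at x)) (at x)" for x
    by (simp add: frechet_derivative_works)
  moreover have "frechet_derivative u (at x) = (\<lambda>h. grad u x \<bullet> h)" for x
  proof
    fix h
    interpret linear "frechet_derivative u (at x)"
      using D[of x] by (rule has_derivative_linear)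
    have "frechet_derivative u (at x) h = frechet_derivative u (at x) (\<Sum>b\<in>Basis. (h \<bullet> b) *\<^sub>R b)"
      by (simp add: euclidean_representation)
    also have "\<dots> = grad u x \<bullet> h"
      by (simp add: sum scale grad_def inner_sum_left inner_sum_right inner_commute mult.commute)
    finally show "frechet_derivative u (at x) h = grad u x \<bullet> h" .
  qed
  ultimately show "(u has_derivative (\<lambda>h. grad u x \<bullet> h)) (at x)" for x by metis
  have "isCont (\<lambda>x. frechet_derivative u (at x) b) x" if b: "b \<in> Basis" for b x
  proof (cases "x \<in> tsupp u")
    case True
    \<comment> \<open>Differentiability of a first partial derivative yields its continuity.\<close>
    then have "iter_partial [b] u differentiable (at x)"
      using u(1)[unfolded smooth_on_def, rule_format, of "[b]" x] b u(3) by auto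
    then show ?thesis by (simp add: differentiable_imp_continuous_within)
  next
    case False
    have "\<forall>\<^sub>F z in nhds x. frechet_derivative u (at z) b = 0"
      using False op D0 by (auto simp: eventually_nhds intro!: exI[of _ "- tsupp u"])
    then show ?thesis by (subst isCont_cong[where g = "\<lambda>_. 0"]) auto
  qed
  then show "continuous_on UNIV (grad u)"
    unfolding grad_def by (auto simp: continuous_on_eq_continuous_at intro!: continuous_intros)
  show "compact (tsupp u)" by fact
qed

text \<open>The indicator of \<open>A\<close> changes nothing since \<open>f\<close> vanishes off
  \<open>A\<close>, and completing the measure does not alter the integral of a Borel
  function.\<close>

lemma set_integral_lebesgue_eq_lborel:
  fixes f :: "'a::euclidean_space \<Rightarrow> real"
  assumes "f \<in> borel_measurable borel" "\<And>x. x \<notin> A \<Longrightarrow> f x = 0"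
  shows "(LINT x:A|lebesgue. f x) = integral\<^sup>L lborel f"
proof -
  have "(\<lambda>x. indicator A x *\<^sub>R f x) = f" using assms(2) by (auto simp: indicator_def fun_eq_iff)
  then show ?thesis
    using assms(1) by (simp add: set_lebesgue_integral_def integral_completion)
qed

theorem theorem2p7:
  fixes \<Omega> :: "'a::euclidean_space set" and u :: "'a \<Rightarrow> real" and s R :: real
  assumes "open \<Omega>" and "\<Omega> \<noteq> UNIV"
    and "bdd_above (bdist \<Omega> ` \<Omega>)" and "R = (SUP x\<in>\<Omega>. bdist \<Omega> x)"
    and "Cc_inf \<Omega> u"
    and "s > real DIM('a)"
  shows "(LINT x:\<Omega>|lebesgue. norm (grad u x) / bdist \<Omega> x powr (s - 1))
           - (s - real DIM('a)) * (LINT x:\<Omega>|lebesgue. \<bar>u x\<bar> / bdist \<Omega> x powr s)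
         \<ge> (1 / R powr (s - real DIM('a)))
             * (LINT x:\<Omega>|lebesgue. norm (grad u x) / bdist \<Omega> x powr (real DIM('a) - 1))"
proof (cases "\<Omega> = {}")
  \<comment> \<open>The supremum over an empty set says nothing about \<open>R\<close>, but here all
    integrals are 0. In the other case a point of \<Omega> shows that \<open>R\<close> is
    positive.\<close>
  case True
  then show ?thesis by (simp add: set_lebesgue_integral_def)
next
  case False
  interpret C1_compact_support u "grad u" "tsupp u"
    using Cc_inf_C1_compact_support assms(1,5) .
  have K: "tsupp u \<subseteq> \<Omega>" using assms(5) by (simp add: Cc_inf_def)
  have zero: "u x = 0" "grad u x = 0" if "x \<notin> \<Omega>" for x using K supp that by auto
  have S: "closed (- \<Omega>)" "- \<Omega> \<noteq> {}" using assms(1,2) by auto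
  have R: "infdist x (- \<Omega>) \<le> R" if "x \<in> \<Omega>" for x
    using cSUP_upper[OF that assms(3)] assms(4) by (simp add: bdist_def)
  obtain x where x: "x \<in> \<Omega>" using False by blast
  then have "0 < infdist x (- \<Omega>)"
    using S infdist_pos_not_in_closed[of "- \<Omega>" x] by auto
  then have R0: "0 < R" using R[OF x] by linarith
  have [measurable]: "(\<lambda>x. infdist x (- \<Omega>)) \<in> borel_measurable borel"
    by (auto intro!: borel_measurable_continuous_onI continuous_intros)
  \<comment> \<open>This holds even at \<open>r = 0\<close>, the value of the distance outside
    \<Omega>: both sides are then 0, as \<open>0 powr q = 0\<close> and division by 0 gives
    0.\<close>
  have div: "a / r powr q = a * r powr (- q)" for a r q :: real
    by (simp add: powr_minus field_simps)
  have "(s - real DIM('a)) * (\<integral>x. \<bar>u x\<bar> * infdist x (- \<Omega>) powr (- s) \<partial>lborel) \<le>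
    (\<integral>x. norm (grad u x) * infdist x (- \<Omega>) powr (1 - s) \<partial>lborel)
      - R powr (real DIM('a) - s)
        * (\<integral>x. norm (grad u x) * infdist x (- \<Omega>) powr (1 - real DIM('a)) \<partial>lborel)"
    by (rule hardy_inequality_infdist) (use S R R0 K assms(6) in auto)
  then show ?thesis
    unfolding bdist_def div
    by (subst (1 2 3) set_integral_lebesgue_eq_lborel) (use zero in auto)
qed

end
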